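(* For $a\in\{0,\dots,p\}$ let $\boldsymbol\kappa^{\langle0\rangle}=\boldsymbol\kappa$ and $\boldsymbol\kappa^{\langle a\rangle}=(\kappa_{a+1},\dots,\kappa_p,\kappa_1+1,\dots,\kappa_a+1)$ for $a\ge1$. Let $\mathscr M^{\langle a\rangle}$ denote the Bessel-like bimoment array with $\boldsymbol\kappa$ replaced by $\boldsymbol\kappa^{\langle a\rangle}$. Then for every $a\in\{0,\dots,p\}$, $j\in\{1,\dots,q\}$, $i\in\{1,\dots,p\}$ and $u,v\in\mathbb N_0$, $$\oint_{\mathbb T}z^{u+v}\Big(C(z)\big(\mathfrak X_{[p]}(z)^a\big)^{\mathsf T}\Big)_{j,i}\frac{\mathrm dz}{2\pi\mathrm i}=\mathscr M^{\langle a\rangle}_{(u,j),(v,i)} .$$ In particular the elementary column Christoffel chain stays inside the Bessel-like moment family, one step realizing the cyclic shift $\boldsymbol\kappa\mapsto\boldsymbol\kappa^{\langle1\rangle}=(\kappa_2,\dots,\kappa_p,\kappa_1+1)$ and one complete cycle giving $\boldsymbol\kappa^{\langle p\rangle}=\boldsymbol\kappa+\mathbf 1_p$.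
   Context: $\mathbf 1_d$: all-ones vector; $\boldsymbol e_j$: standard basis vector; $\Gamma(\boldsymbol v)=\prod_h\Gamma(v_h)$ (empty product $1$); $\mathbb T$: positively oriented unit circle. Parameters $p,q\ge1$, $0\le r<q$, $\boldsymbol a\in\mathbb C^r$, $\boldsymbol b\in\mathbb C^q$, $\boldsymbol\kappa\in\mathbb C^p$ (regular: $b_j-b_h\notin\mathbb Z$ for $j\ne h$, $\kappa_i-\kappa_h\notin\mathbb Z$ for $i\ne h$), with $\kappa_i+a_\rho+1\notin\{0,-1,\dots\}$ for all $i,\rho$. $C(z)=[C_{j,i}(z)]$ is the $q\times p$ matrix with $C_{j,i}(z)=\sum_{k\ge0}\frac{\Gamma((k+\kappa_i)\mathbf 1_r+\boldsymbol a+\mathbf 1_r)}{\Gamma((k+\kappa_i)\mathbf 1_q+\boldsymbol b+\boldsymbol e_j+\mathbf 1_q)}z^{-k-1}$. Bimoment array: $\mathscr M_{(u,j),(v,i)}=\dfrac{\Gamma((u+v+1+\kappa_i)\mathbf 1_r+\boldsymbol a)}{\Gamma((u+v+1+\kappa_i)\mathbf 1_q+\boldsymbol b+\boldsymbol e_j)}$, $u,v\in\mathbb N_0$. $\mathfrak X_{[1]}(z)=z$, and for $p\ge2$, $\mathfrak X_{[p]}(z)$ is the $p\times p$ matrix with entries $1$ at positions $(i,i+1)$, $1\le i\le p-1$, entry $z$ at position $(p,1)$, and zeros elsewhere. A column Christoffel step is right multiplication of $C(z)$ by $\mathfrak X_{[p]}(z)^{\mathsf T}$. *)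

theory Defs
  imports
    "HOL-Complex_Analysis.Complex_Analysis"
    "Jordan_Normal_Form.Matrix"
begin

no_notation vec_nth (infixl \<open>$\<close> 90)
hide_type (open) Finite_Cartesian_Product.vec
hide_const (open) Finite_Cartesian_Product.vec

text \<open>
  The dimensions \<open>p\<close>, \<open>q\<close>, \<open>r\<close> are natural numbers (\<open>r\<close> may be \<open>0\<close>, and the
  order of the indices below \<open>p\<close> matters), so vectors and matrices are those of
  \<^theory>\<open>Jordan_Normal_Form.Matrix\<close>.  All indices are zero-based: the entry with
  mathematical index \<open>(j, i)\<close>, \<open>1 \<le> j \<le> q\<close>, \<open>1 \<le> i \<le> p\<close>, is \<open>(j - 1, i - 1)\<close> here.
\<close>

definition ones_vec :: "nat \<Rightarrow> complex Matrix.vec" where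
  "ones_vec d = Matrix.vec d (\<lambda>_. 1)"

text \<open>
  In the quotients below, \<^const>\<open>Gamma\<close> is \<open>0\<close> at its poles and division by \<open>0\<close>
  gives \<open>0\<close>.  A denominator with a pole therefore contributes \<open>0\<close>, which is the value
  of the entire function \<open>1 / \<Gamma>\<close>.
\<close>

definition Gamma_vec :: "complex Matrix.vec \<Rightarrow> complex" where
  "Gamma_vec v = (\<Prod>h<dim_vec v. Gamma (v $ h))"

definition regular_vec :: "complex Matrix.vec \<Rightarrow> bool" where
  "regular_vec v \<longleftrightarrow>
     (\<forall>j<dim_vec v. \<forall>h<dim_vec v. j \<noteq> h \<longrightarrow> v $ j - v $ h \<notin> \<int>)"

definition bessel_parameters ::
  "nat \<Rightarrow> nat \<Rightarrow> nat \<Rightarrow> complex Matrix.vec \<Rightarrow> complex Matrix.vec \<Rightarrow> complex Matrix.vec \<Rightarrow> bool"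
where
  "bessel_parameters p q r a b \<kappa> \<longleftrightarrow>
     1 \<le> p \<and> 1 \<le> q \<and> r < q \<and>
     a \<in> carrier_vec r \<and> b \<in> carrier_vec q \<and> \<kappa> \<in> carrier_vec p \<and>
     regular_vec b \<and> regular_vec \<kappa> \<and>
     (\<forall>i<p. \<forall>\<rho><r. \<kappa> $ i + a $ \<rho> + 1 \<notin> \<int>\<^sub>\<le>\<^sub>0)"

definition bessel_C ::
  "complex Matrix.vec \<Rightarrow> complex Matrix.vec \<Rightarrow> complex Matrix.vec \<Rightarrow> complex \<Rightarrow> complex mat"
where
  "bessel_C a b \<kappa> z =
     (let r = dim_vec a; q = dim_vec b; p = dim_vec \<kappa> in
      mat q p (\<lambda>(j, i). \<Sum>k.
        Gamma_vec ((of_nat k + \<kappa> $ i) \<cdot>\<^sub>v ones_vec r + a + ones_vec r)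
        / Gamma_vec ((of_nat k + \<kappa> $ i) \<cdot>\<^sub>v ones_vec q + b + unit_vec q j + ones_vec q)
        * z powi (- int k - 1)))"

definition bessel_bimoment ::
  "complex Matrix.vec \<Rightarrow> complex Matrix.vec \<Rightarrow> complex Matrix.vec
     \<Rightarrow> nat \<times> nat \<Rightarrow> nat \<times> nat \<Rightarrow> complex"
where
  "bessel_bimoment a b \<kappa> = (\<lambda>(u, j) (v, i).
     (let r = dim_vec a; q = dim_vec b in
      Gamma_vec ((of_nat (u + v + 1) + \<kappa> $ i) \<cdot>\<^sub>v ones_vec r + a)
      / Gamma_vec ((of_nat (u + v + 1) + \<kappa> $ i) \<cdot>\<^sub>v ones_vec q + b + unit_vec q j)))"

text \<open>For \<open>p = 1\<close> only the second case applies, and the matrix is \<open>(z)\<close>.\<close>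

definition X_mat :: "nat \<Rightarrow> complex \<Rightarrow> complex mat" where
  "X_mat p z = mat p p (\<lambda>(i, l).
     if l = i + 1 then 1 else if i + 1 = p \<and> l = 0 then z else 0)"

definition column_christoffel_step ::
  "nat \<Rightarrow> (complex \<Rightarrow> complex mat) \<Rightarrow> (complex \<Rightarrow> complex mat)"
where
  "column_christoffel_step p F = (\<lambda>z. F z * transpose_mat (X_mat p z))"

text \<open>
  \<open>\<kappa>\<^sup>\<langle>\<^sup>s\<^sup>\<rangle> = (\<kappa>\<^sub>s\<^sub>+\<^sub>1, \<dots>, \<kappa>\<^sub>p, \<kappa>\<^sub>1 + 1, \<dots>, \<kappa>\<^sub>s + 1)\<close>, meant for \<open>s \<le> p\<close>.
\<close>

definition kappa_shift :: "complex Matrix.vec \<Rightarrow> nat \<Rightarrow> complex Matrix.vec" where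
  "kappa_shift \<kappa> s = vec_last \<kappa> (dim_vec \<kappa> - s) @\<^sub>v (vec_first \<kappa> s + ones_vec s)"

lemma kappa_shift_0 [simp]: "kappa_shift \<kappa> 0 = \<kappa>"
  by (rule eq_vecI) (auto simp: kappa_shift_def vec_last_def ones_vec_def)

end

theory Submission
  imports Defs
begin

text \<open>
  Since \<open>r < q\<close>, the quotients of consecutive coefficients of the series for \<open>C\<close> tend to
  \<open>0\<close>, so the series converges uniformly on the unit circle and may be integrated termwise:
  the moments of \<open>C\<close> are its coefficients.  Row \<open>i\<close> of \<open>X\<^sup>s\<close> has a single nonzero
  entry, in the column cyclically shifted by \<open>s\<close>, with a factor \<open>z\<close> after a wrap-around.
  That factor raises the moment index by one, which amounts to replacing \<open>\<kappa>\<close> by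
  \<open>\<kappa> + 1\<close> in the coefficient.
\<close>

no_notation fps_nth (infixl \<open>$\<close> 75)

section \<open>Moments of Laurent series on the unit circle\<close>

text \<open>For \<open>n = -1\<close> this is Cauchy's formula for the constant function
  \<open>1\<close>. Every other power has a primitive on the punctured plane, and the circle is
  closed.\<close>

lemma has_contour_integral_powi_circlepath:
  assumes "R > 0"
  shows "((\<lambda>z. z powi n) has_contour_integral (if n = -1 then 2 * of_real pi * \<i> else 0))
           (circlepath 0 R)"
proof (cases "n = -1")
  case True
  have "((\<lambda>z. 1 / (z - 0)) has_contour_integral 2 * of_real pi * \<i> * 1) (circlepath 0 R)"
    by (rule Cauchy_integral_circlepath_simple) (use assms in auto)
  then show ?thesis
    using True by (simp add: power_int_minus divide_inverse)
next
  case False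
  have "((\<lambda>z. z powi (n + 1) / of_int (n + 1)) has_field_derivative z powi n) (at z within - {0})"
    if "z \<in> - {0}" for z :: complex
    using that False by (auto intro!: derivative_eq_intros simp del: of_int_add)
  moreover have "path_image (circlepath 0 R) \<subseteq> - {0}"
    using assms by auto
  ultimately have "((\<lambda>z. z powi n) has_contour_integral
      pathfinish (circlepath 0 R) powi (n + 1) / of_int (n + 1)
        - pathstart (circlepath 0 R) powi (n + 1) / of_int (n + 1)) (circlepath 0 R)"
    by (intro contour_integral_primitive valid_path_circlepath)
  then show ?thesis
    using False by (simp del: of_int_add)
qed

text \<open>On the unit circle the terms are bounded by \<open>norm (c k)\<close>, so the M-test
  allows termwise integration. Only the term \<open>k = n\<close> has total exponent
  \<open>-1\<close>.\<close>

lemma has_contour_integral_power_times_laurent_series: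
  fixes c :: "nat \<Rightarrow> complex"
  assumes "summable (\<lambda>k. norm (c k))"
  shows "((\<lambda>z. z ^ n * (\<Sum>k. c k * z powi (- int k - 1))) has_contour_integral
           2 * of_real pi * \<i> * c n) (circlepath 0 1)"
proof -
  let ?S = "\<lambda>N z. \<Sum>k<N. z ^ n * (c k * z powi (- int k - 1))"
  let ?T = "\<lambda>z. \<Sum>k. z ^ n * (c k * z powi (- int k - 1))"
  have summand: "((\<lambda>z. z ^ n * (c k * z powi (- int k - 1))) has_contour_integral
      (if k = n then 2 * of_real pi * \<i> * c n else 0)) (circlepath 0 1)" for k
  proof -
    have "((\<lambda>z. c k * z powi (int n - int k - 1)) has_contour_integral
        c k * (if int n - int k - 1 = -1 then 2 * of_real pi * \<i> else 0)) (circlepath 0 1)"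
      by (intro has_contour_integral_lmul has_contour_integral_powi_circlepath) simp
    then have "((\<lambda>z. c k * z powi (int n - int k - 1)) has_contour_integral
        (if k = n then 2 * of_real pi * \<i> * c n else 0)) (circlepath 0 1)"
      by (auto simp: mult_ac split: if_splits)
    \<comment> \<open>Exponents may be added only for nonzero \<open>z\<close>: at \<open>0\<close>
      and \<open>n = k + 1\<close> the two sides take the values \<open>c k\<close> and
      \<open>0\<close>. Agreement on the path suffices.\<close>
    moreover have "c k * z powi (int n - int k - 1) = z ^ n * (c k * z powi (- int k - 1))"
      if "z \<in> path_image (circlepath 0 1)" for z
    proof -
      have "z \<noteq> 0" using that by auto
      then have "z powi (int n + (- int k - 1)) = z powi int n * z powi (- int k - 1)"
        by (intro power_int_add) simp
      then show ?thesis by (simp add: algebra_simps)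
    qed
    ultimately show ?thesis
      by (rule has_contour_integral_eq)
  qed
  have partial: "(?S N has_contour_integral
      (\<Sum>k<N. if k = n then 2 * of_real pi * \<i> * c n else 0)) (circlepath 0 1)" for N
    by (intro has_contour_integral_sum summand) auto
  have norm_term: "norm (z ^ n * (c k * z powi (- int k - 1))) \<le> norm (c k)"
    if "norm z = 1" for z k
    using that by (simp add: norm_mult norm_power norm_power_int)
  have unif: "uniform_limit (sphere 0 1) ?S ?T sequentially"
    by (rule Weierstrass_m_test [OF _ assms]) (use norm_term in auto)
  have T: "?T contour_integrable_on circlepath 0 1"
    "((\<lambda>N. contour_integral (circlepath 0 1) (?S N)) \<longlongrightarrow> contour_integral (circlepath 0 1) ?T)
       sequentially"
    by (rule contour_integral_uniform_limit_circlepath [OF always_eventually unif];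
        use partial in \<open>auto simp only: contour_integrable_on_def sequentially_bot zero_less_one\<close>)+
  \<comment> \<open>The integrals of the partial sums are constant as soon as the term
    \<open>k = n\<close> is included.\<close>
  have "(\<lambda>N. contour_integral (circlepath 0 1) (?S N)) \<longlonglongrightarrow> 2 * of_real pi * \<i> * c n"
  proof (rule tendsto_eventually, rule eventually_sequentiallyI [of "Suc n"])
    show "contour_integral (circlepath 0 1) (?S N) = 2 * of_real pi * \<i> * c n" if "Suc n \<le> N" for N
      using that contour_integral_unique [OF partial] by simp
  qed
  with T(2) have "contour_integral (circlepath 0 1) ?T = 2 * of_real pi * \<i> * c n"
    by (rule LIMSEQ_unique)
  with has_contour_integral_integral [OF T(1)]
  have "(?T has_contour_integral 2 * of_real pi * \<i> * c n) (circlepath 0 1)"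
    by (simp only:)
  moreover have "?T z = z ^ n * (\<Sum>k. c k * z powi (- int k - 1))"
    if "z \<in> path_image (circlepath 0 1)" for z
  proof (rule suminf_mult)
    show "summable (\<lambda>k. c k * z powi (- int k - 1))"
      by (rule summable_norm_cancel)
        (use that assms in \<open>simp add: norm_mult norm_power_int\<close>)
  qed
  ultimately show ?thesis
    by (rule has_contour_integral_eq)
qed

section \<open>Summability of the Gamma quotients\<close>

lemma tendsto_shifted_quotient:
  fixes x y :: complex
  shows "(\<lambda>k. (of_nat k + x) / (of_nat k + y)) \<longlonglongrightarrow> 1"
    and "(\<lambda>k. 1 / (of_nat k + y)) \<longlonglongrightarrow> 0"
proof -
  have inf: "filterlim (\<lambda>k. of_nat k + y) at_infinity sequentially"
    by (rule tendsto_add_filterlim_at_infinity' [OF tendsto_of_nat tendsto_const])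
  show lim: "(\<lambda>k. 1 / (of_nat k + y)) \<longlonglongrightarrow> 0"
    by (intro tendsto_divide_0 [OF tendsto_const inf])
  \<comment> \<open>If \<open>y\<close> is a nonpositive integer, one denominator vanishes, so the
    rewriting below is only eventual.\<close>
  have "\<forall>\<^sub>F k in sequentially. of_nat k + y \<noteq> 0"
    using inf by (rule filterlim_at_infinity_imp_eventually_ne)
  then have "\<forall>\<^sub>F k in sequentially.
      1 + (x - y) * (1 / (of_nat k + y)) = (of_nat k + x) / (of_nat k + y)"
    by eventually_elim (simp add: field_simps)
  moreover have "(\<lambda>k. 1 + (x - y) * (1 / (of_nat k + y))) \<longlonglongrightarrow> 1 + (x - y) * 0"
    by (intro tendsto_intros lim)
  ultimately show "(\<lambda>k. (of_nat k + x) / (of_nat k + y)) \<longlonglongrightarrow> 1"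
    by (simp add: filterlim_cong)
qed

lemma eventually_not_nonpos_Int:
  fixes x :: complex
  shows "\<forall>\<^sub>F k in sequentially. of_nat k + x \<notin> \<int>\<^sub>\<le>\<^sub>0"
proof -
  have "\<forall>\<^sub>F k in sequentially. real k > - Re x"
    using filterlim_real_sequentially by (rule filterlim_at_top_dense [THEN iffD1, rule_format])
  then show ?thesis
    by eventually_elim (auto elim!: nonpos_Ints_cases simp: complex_eq_iff)
qed

text \<open>Ratio test: by the recurrence of Gamma, the quotient of consecutive terms is a product
  of \<open>r\<close> factors tending to \<open>1\<close> and \<open>q - r > 0\<close> factors
  tending to \<open>0\<close>. Poles affect only finitely many \<open>k\<close>.\<close>

lemma summable_Gamma_quotient:
  fixes x y :: "nat \<Rightarrow> complex"
  assumes "r < q"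
  shows "summable (\<lambda>k. norm ((\<Prod>h<r. Gamma (of_nat k + x h)) / (\<Prod>h<q. Gamma (of_nat k + y h))))"
    (is "summable (\<lambda>k. norm (?c k))")
proof -
  \<comment> \<open>Each numerator factor is paired with a denominator factor, so that the limit can
    be taken factor by factor.\<close>
  let ?R = "\<lambda>k. \<Prod>h<q. (if h < r then (of_nat k + x h) / (of_nat k + y h) else 1 / (of_nat k + y h))"
  have step: "\<forall>\<^sub>F k in sequentially. ?c (Suc k) = ?R k * ?c k"
  proof -
    have "\<forall>\<^sub>F k in sequentially. \<forall>h\<in>{..<r}. of_nat k + x h \<notin> \<int>\<^sub>\<le>\<^sub>0"
      "\<forall>\<^sub>F k in sequentially. \<forall>h\<in>{..<q}. of_nat k + y h \<notin> \<int>\<^sub>\<le>\<^sub>0"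
      by (simp_all add: eventually_ball_finite eventually_not_nonpos_Int)
    then show ?thesis
    proof eventually_elim
      case (elim k)
      have G: "Gamma (of_nat (Suc k) + w) = (of_nat k + w) * Gamma (of_nat k + w)"
        if "of_nat k + w \<notin> \<int>\<^sub>\<le>\<^sub>0" for w :: complex
        using Gamma_plus1 [of "of_nat k + w"] that by (auto simp: add_ac)
      have num: "(\<Prod>h<r. Gamma (of_nat (Suc k) + x h))
          = (\<Prod>h<r. of_nat k + x h) * (\<Prod>h<r. Gamma (of_nat k + x h))"
        unfolding prod.distrib [symmetric] by (intro prod.cong refl G) (use elim in auto)
      have den: "(\<Prod>h<q. Gamma (of_nat (Suc k) + y h))
          = (\<Prod>h<q. of_nat k + y h) * (\<Prod>h<q. Gamma (of_nat k + y h))"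
        unfolding prod.distrib [symmetric] by (intro prod.cong refl G) (use elim in auto)
      have "?R k = (\<Prod>h<q. (if h < r then of_nat k + x h else 1) / (of_nat k + y h))"
        by (intro prod.cong) auto
      also have "\<dots> = (\<Prod>h<q. if h < r then of_nat k + x h else 1) / (\<Prod>h<q. of_nat k + y h)"
        by (rule prod_dividef)
      also have "(\<Prod>h<q. if h < r then of_nat k + x h else 1) = (\<Prod>h<r. of_nat k + x h)"
        by (rule prod.mono_neutral_cong_right) (use assms in auto)
      finally show ?case
        unfolding num den by simp
    qed
  qed
  have "?R \<longlonglongrightarrow> (\<Prod>h<q. if h < r then 1 else 0)"
    by (intro tendsto_prod) (simp add: tendsto_shifted_quotient split: if_splits)
  \<comment> \<open>The factor \<open>h = r\<close> vanishes; it is present because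
    \<open>r < q\<close>.\<close>
  moreover have "(\<Prod>h<q. if h < r then 1 else 0) = (0 :: complex)"
    using assms by (auto intro!: prod_zero)
  ultimately have "(\<lambda>k. norm (?R k)) \<longlonglongrightarrow> 0"
    by (simp add: tendsto_norm_zero)
  then have "\<forall>\<^sub>F k in sequentially. norm (?R k) < 1 / 2"
    by (rule order_tendstoD) simp
  with step have "\<forall>\<^sub>F k in sequentially. norm (?c (Suc k)) \<le> 1 / 2 * norm (?c k)"
  proof eventually_elim
    case (elim k)
    then show ?case
      unfolding elim(1) norm_mult by (intro mult_mono) auto
  qed
  then obtain N where "\<And>k. k \<ge> N \<Longrightarrow> norm (?c (Suc k)) \<le> 1 / 2 * norm (?c k)"
    by (auto simp: eventually_sequentially)
  then show ?thesis
    by (intro summable_ratio_test [of "1 / 2" N]) simp_all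
qed

section \<open>Moments of \<open>bessel_C\<close>\<close>

text \<open>This is the shape treated by \<open>summable_Gamma_quotient\<close>, with
  \<open>u + v\<close> as the running index and everything else as a fixed parameter.\<close>

lemma bessel_bimoment_eq:
  assumes "a \<in> carrier_vec r" "b \<in> carrier_vec q"
  shows "bessel_bimoment a b \<kappa> (u, j) (v, i)
    = (\<Prod>h<r. Gamma (of_nat (u + v) + (\<kappa> $ i + a $ h + 1)))
      / (\<Prod>h<q. Gamma (of_nat (u + v) + (\<kappa> $ i + b $ h + unit_vec q j $ h + 1)))"
  using assms
  by (auto simp: bessel_bimoment_def Gamma_vec_def ones_vec_def add_ac
      intro!: arg_cong2 [where f = "(/)"] prod.cong)

text \<open>The extra \<open>ones_vec\<close> in the Gamma arguments of the series is the
  \<open>1\<close> in \<open>u + v + 1\<close>, so the series coefficients are bimoments with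
  \<open>u = 0\<close>.\<close>

lemma bessel_C_index:
  assumes "a \<in> carrier_vec r" "b \<in> carrier_vec q" "\<kappa> \<in> carrier_vec p" "j < q" "i < p"
  shows "bessel_C a b \<kappa> z $$ (j, i)
    = (\<Sum>k. bessel_bimoment a b \<kappa> (0, j) (k, i) * z powi (- int k - 1))"
  using assms
  by (auto simp: bessel_C_def bessel_bimoment_def Gamma_vec_def ones_vec_def add_ac
      intro!: suminf_cong arg_cong2 [where f = "(*)"] arg_cong2 [where f = "(/)"] prod.cong)

lemma bessel_C_moment:
  assumes "bessel_parameters p q r a b \<kappa>" "j < q" "i < p"
  shows "((\<lambda>z. z ^ n * bessel_C a b \<kappa> z $$ (j, i) / (2 * of_real pi * \<i>)) has_contour_integral
           bessel_bimoment a b \<kappa> (0, j) (n, i)) (circlepath 0 1)"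
proof -
  have par: "a \<in> carrier_vec r" "b \<in> carrier_vec q" "\<kappa> \<in> carrier_vec p" "r < q"
    using assms by (auto simp: bessel_parameters_def)
  have "summable (\<lambda>k. norm (bessel_bimoment a b \<kappa> (0, j) (k, i)))"
    unfolding bessel_bimoment_eq [OF par(1,2)] add_0 by (rule summable_Gamma_quotient [OF par(4)])
  from has_contour_integral_div [OF has_contour_integral_power_times_laurent_series [OF this],
      of n "2 * of_real pi * \<i>"]
  show ?thesis
    by (simp add: bessel_C_index [OF par(1-3) assms(2,3)])
qed

section \<open>Powers of \<open>X_mat\<close> and iterated Christoffel steps\<close>

lemma X_mat_carrier [simp]: "X_mat p z \<in> carrier_mat p p"
  by (simp add: X_mat_def)

text \<open>Each factor advances the column by one cyclically and contributes \<open>z\<close> on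
  wrapping. Since \<open>s \<le> p\<close>, a row wraps at most once, so no higher power of
  \<open>z\<close> occurs.\<close>

lemma X_mat_pow_index:
  assumes "s \<le> p" "i < p" "l < p"
  shows "(X_mat p z ^\<^sub>m s) $$ (i, l)
    = (if l = i + s then 1 else if l + p = i + s then z else 0)"
  using assms
proof (induction s arbitrary: l)
  case 0
  then show ?case by (auto simp: X_mat_def)
next
  case (Suc s)
  have "(X_mat p z ^\<^sub>m Suc s) $$ (i, l)
      = (\<Sum>m<p. (X_mat p z ^\<^sub>m s) $$ (i, m) * X_mat p z $$ (m, l))"
    using Suc.prems
    by (simp add: scalar_prod_def pow_carrier_mat[OF X_mat_carrier] atLeast0LessThan X_mat_def)
  also have "\<dots> = (\<Sum>m<p. (if m = i + s then 1 else if m + p = i + s then z else 0) * X_mat p z $$ (m, l))"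
    using Suc by (intro sum.cong) auto
  \<comment> \<open>As \<open>i + s < 2 * p\<close>, exactly one of the two cases is met by an index
    \<open>m < p\<close>; naming that index collapses the sum.\<close>
  also have "\<dots> = (\<Sum>m<p. if m = (if i + s < p then i + s else i + s - p)
      then (if i + s < p then 1 else z) * X_mat p z $$ (m, l) else 0)"
    using Suc.prems by (intro sum.cong) auto
  also have "\<dots> = (if i + s < p then 1 else z) * X_mat p z $$ (if i + s < p then i + s else i + s - p, l)"
    using Suc.prems by auto
  also have "\<dots> = (if l = i + Suc s then 1 else if l + p = i + Suc s then z else 0)"
    using Suc.prems by (auto simp: X_mat_def)
  finally show ?case .
qed

lemma mult_transpose_X_mat_pow_index:
  assumes "A \<in> carrier_mat q p" "s \<le> p" "j < q" "i < p"
  shows "(A * transpose_mat (X_mat p z ^\<^sub>m s)) $$ (j, i)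
    = (if i + s < p then A $$ (j, i + s) else z * A $$ (j, i + s - p))"
proof -
  have "(A * transpose_mat (X_mat p z ^\<^sub>m s)) $$ (j, i)
      = (\<Sum>l<p. A $$ (j, l) * (X_mat p z ^\<^sub>m s) $$ (i, l))"
    using assms carrier_matD [OF assms(1)] carrier_matD [OF X_mat_carrier]
    by (simp add: scalar_prod_def atLeast0LessThan)
  also have "\<dots> = (\<Sum>l<p. if l = (if i + s < p then i + s else i + s - p)
      then (if i + s < p then 1 else z) * A $$ (j, l) else 0)"
    using assms by (intro sum.cong) (auto simp: X_mat_pow_index)
  also have "\<dots> = (if i + s < p then A $$ (j, i + s) else z * A $$ (j, i + s - p))"
    using assms by auto
  finally show ?thesis .
qed

text \<open>The recursion of \<open>^\<^sub>m\<close> multiplies on the right. Transposition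
  reverses products, so a further column step needs the new factor on the left.\<close>

lemma pow_mat_Suc_left:
  assumes "A \<in> carrier_mat n n"
  shows "A ^\<^sub>m Suc s = A * A ^\<^sub>m s"
proof (induction s)
  case 0
  then show ?case using assms by simp
next
  case (Suc s)
  have "A ^\<^sub>m Suc (Suc s) = A * A ^\<^sub>m s * A"
    using Suc.IH by simp
  also have "\<dots> = A * (A ^\<^sub>m s * A)"
    by (rule assoc_mult_mat [OF assms pow_carrier_mat [OF assms] assms])
  finally show ?case by simp
qed

lemma column_christoffel_step_funpow:
  assumes "F z \<in> carrier_mat q p"
  shows "(column_christoffel_step p ^^ s) F z = F z * transpose_mat (X_mat p z ^\<^sub>m s)"
proof (induction s)
  case 0
  then show ?case using assms by (simp add: X_mat_def)
next
  case (Suc s)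
  have pow: "X_mat p z ^\<^sub>m s \<in> carrier_mat p p"
    by (rule pow_carrier_mat) simp
  have "(column_christoffel_step p ^^ Suc s) F z
      = F z * transpose_mat (X_mat p z ^\<^sub>m s) * transpose_mat (X_mat p z)"
    by (simp add: column_christoffel_step_def Suc.IH)
  also have "\<dots> = F z * transpose_mat (X_mat p z * X_mat p z ^\<^sub>m s)"
    using assms pow by (simp add: transpose_mult [OF X_mat_carrier pow] assoc_mult_mat [of _ q p _ p _ p])
  finally show ?case by (simp only: pow_mat_Suc_left [OF X_mat_carrier])
qed

section \<open>The cyclic shift of the parameters\<close>

lemma dim_kappa_shift [simp]: "s \<le> dim_vec \<kappa> \<Longrightarrow> dim_vec (kappa_shift \<kappa> s) = dim_vec \<kappa>"
  by (simp add: kappa_shift_def ones_vec_def)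

text \<open>The wrap-around condition is the one in \<open>mult_transpose_X_mat_pow_index\<close>,
  so the same case split serves both.\<close>

lemma kappa_shift_index:
  assumes "s \<le> dim_vec \<kappa>" "i < dim_vec \<kappa>"
  shows "kappa_shift \<kappa> s $ i
    = (if i + s < dim_vec \<kappa> then \<kappa> $ (i + s) else \<kappa> $ (i + s - dim_vec \<kappa>) + 1)"
  using assms
  by (auto simp: kappa_shift_def vec_last_def vec_first_def ones_vec_def add.commute less_diff_conv)

lemma kappa_shift_Suc:
  assumes "s < dim_vec \<kappa>"
  shows "kappa_shift \<kappa> (s + 1) = kappa_shift (kappa_shift \<kappa> s) 1"
  using assms
  by (intro eq_vecI) (auto simp: kappa_shift_index intro!: arg_cong [where f = "vec_index \<kappa>"])

text \<open>Entries are permuted and raised by \<open>0\<close> or \<open>1\<close>. Integer shifts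
  keep differences outside the integers, and raising by \<open>1\<close> cannot lead into the
  nonpositive integers from outside.\<close>

lemma bessel_parameters_kappa_shift:
  assumes "bessel_parameters p q r a b \<kappa>" "s \<le> p"
  shows "bessel_parameters p q r a b (kappa_shift \<kappa> s)"
proof -
  have dim: "dim_vec \<kappa> = p" using assms by (auto simp: bessel_parameters_def)
  have "regular_vec (kappa_shift \<kappa> s)"
    unfolding regular_vec_def
  proof (intro allI impI)
    fix i h assume ih: "i < dim_vec (kappa_shift \<kappa> s)" "h < dim_vec (kappa_shift \<kappa> s)" "i \<noteq> h"
    \<comment> \<open>\<open>\<sigma> i\<close> is the position in \<open>\<kappa>\<close> from
      which entry \<open>i\<close> comes; distinct entries come from distinct positions.\<close>
    define \<sigma> where "\<sigma> i = (if i + s < p then i + s else i + s - p)" for i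
    have \<sigma>: "\<sigma> i < p" "\<sigma> h < p" "\<sigma> i \<noteq> \<sigma> h"
      using ih assms(2) dim by (auto simp: \<sigma>_def split: if_splits)
    have "kappa_shift \<kappa> s $ m = \<kappa> $ \<sigma> m + of_int (if m + s < p then 0 else 1)" if "m < p" for m
      using that assms(2) dim by (simp add: kappa_shift_index \<sigma>_def)
    then obtain k l :: int
      where "kappa_shift \<kappa> s $ i = \<kappa> $ \<sigma> i + of_int k" "kappa_shift \<kappa> s $ h = \<kappa> $ \<sigma> h + of_int l"
      using ih assms(2) dim by (metis dim_kappa_shift)
    then have "\<kappa> $ \<sigma> i - \<kappa> $ \<sigma> h = (kappa_shift \<kappa> s $ i - kappa_shift \<kappa> s $ h) + of_int (l - k)"
      by simp
    moreover have "\<kappa> $ \<sigma> i - \<kappa> $ \<sigma> h \<notin> \<int>"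
      using assms(1) \<sigma> dim by (auto simp: bessel_parameters_def regular_vec_def)
    ultimately show "kappa_shift \<kappa> s $ i - kappa_shift \<kappa> s $ h \<notin> \<int>"
      by (metis Ints_add Ints_of_int)
  qed
  moreover have "kappa_shift \<kappa> s $ i + a $ \<rho> + 1 \<notin> \<int>\<^sub>\<le>\<^sub>0" if "i < p" "\<rho> < r" for i \<rho>
  proof -
    have hyp: "\<kappa> $ m + a $ \<rho> + 1 \<notin> \<int>\<^sub>\<le>\<^sub>0" if "m < p" for m
      using assms(1) that \<open>\<rho> < r\<close> by (auto simp: bessel_parameters_def)
    then have "\<kappa> $ m + a $ \<rho> + 1 + 1 \<notin> \<int>\<^sub>\<le>\<^sub>0" if "m < p" for m
      using that plus_one_in_nonpos_Ints_imp by blast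
    then have "\<kappa> $ m + 1 + a $ \<rho> + 1 \<notin> \<int>\<^sub>\<le>\<^sub>0" if "m < p" for m
      using that by (simp add: add_ac)
    with hyp show ?thesis
      using that assms(2) dim by (simp add: kappa_shift_index)
  qed
  moreover have "kappa_shift \<kappa> s \<in> carrier_vec p"
    using assms(2) dim by (intro carrier_vecI) simp
  ultimately show ?thesis
    using assms(1) unfolding bessel_parameters_def by blast
qed

text \<open>The bimoments depend on \<open>u\<close>, \<open>v\<close> and the chosen entry of
  \<open>\<kappa>\<close> only through \<open>u + v + 1 + \<kappa> $ i\<close>, so the unit gained
  by a wrapped entry can be moved into the moment index.\<close>

lemma bessel_bimoment_kappa_shift:
  assumes "s \<le> dim_vec \<kappa>" "i < dim_vec \<kappa>"
  shows "bessel_bimoment a b (kappa_shift \<kappa> s) (u, j) (v, i)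
    = (if i + s < dim_vec \<kappa> then bessel_bimoment a b \<kappa> (0, j) (u + v, i + s)
       else bessel_bimoment a b \<kappa> (0, j) (Suc (u + v), i + s - dim_vec \<kappa>))"
  using assms by (simp add: bessel_bimoment_def kappa_shift_index add_ac)

theorem lemma8p1:
  fixes p q r :: nat and a b \<kappa> :: "complex Matrix.vec"
  assumes "bessel_parameters p q r a b \<kappa>"
  shows
    "(\<forall>s\<le>p. \<forall>j<q. \<forall>i<p. \<forall>u v.
        ((\<lambda>z. z ^ (u + v) * (bessel_C a b \<kappa> z * transpose_mat (X_mat p z ^\<^sub>m s)) $$ (j, i)
              / (2 * of_real pi * \<i>))
          has_contour_integral bessel_bimoment a b (kappa_shift \<kappa> s) (u, j) (v, i))
        (circlepath 0 1)) \<and>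
     (\<forall>s\<le>p. \<forall>z.
        (column_christoffel_step p ^^ s) (bessel_C a b \<kappa>) z
          = bessel_C a b \<kappa> z * transpose_mat (X_mat p z ^\<^sub>m s)) \<and>
     (\<forall>s\<le>p. bessel_parameters p q r a b (kappa_shift \<kappa> s)) \<and>
     (\<forall>s<p. kappa_shift \<kappa> (s + 1) = kappa_shift (kappa_shift \<kappa> s) 1) \<and>
     kappa_shift \<kappa> 1 = Matrix.vec p (\<lambda>i. if i + 1 < p then \<kappa> $ (i + 1) else \<kappa> $ 0 + 1) \<and>
     kappa_shift \<kappa> p = \<kappa> + ones_vec p"
proof (intro conjI allI impI)
  have dim: "dim_vec \<kappa> = p" "dim_vec b = q" "1 \<le> p"
    using assms by (auto simp: bessel_parameters_def)
  have C: "bessel_C a b \<kappa> z \<in> carrier_mat q p" for z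
    using dim by (simp add: bessel_C_def Let_def)
  show "((\<lambda>z. z ^ (u + v) * (bessel_C a b \<kappa> z * transpose_mat (X_mat p z ^\<^sub>m s)) $$ (j, i)
              / (2 * of_real pi * \<i>))
          has_contour_integral bessel_bimoment a b (kappa_shift \<kappa> s) (u, j) (v, i))
        (circlepath 0 1)"
    if "s \<le> p" "j < q" "i < p" for s j i u v
  proof (cases "i + s < p")
    case True
    with bessel_C_moment [OF assms \<open>j < q\<close> True, of "u + v"] that dim show ?thesis
      by (simp add: mult_transpose_X_mat_pow_index [OF C] bessel_bimoment_kappa_shift)
  next
    case False
    then have "i + s - p < p" using that by simp
    \<comment> \<open>The factor \<open>z\<close> of the wrapped column is absorbed into the power,
      which accounts for the exponent \<open>Suc (u + v)\<close>.\<close>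
    from bessel_C_moment [OF assms \<open>j < q\<close> this, of "Suc (u + v)"] that dim False show ?thesis
      by (simp add: mult_transpose_X_mat_pow_index [OF C] bessel_bimoment_kappa_shift mult_ac)
  qed
  show "(column_christoffel_step p ^^ s) (bessel_C a b \<kappa>) z
          = bessel_C a b \<kappa> z * transpose_mat (X_mat p z ^\<^sub>m s)" for s z
    using C by (rule column_christoffel_step_funpow)
  show "bessel_parameters p q r a b (kappa_shift \<kappa> s)" if "s \<le> p" for s
    using assms that by (rule bessel_parameters_kappa_shift)
  show "kappa_shift \<kappa> (s + 1) = kappa_shift (kappa_shift \<kappa> s) 1" if "s < p" for s
    using that dim by (intro kappa_shift_Suc) simp
  show "kappa_shift \<kappa> 1 = Matrix.vec p (\<lambda>i. if i + 1 < p then \<kappa> $ (i + 1) else \<kappa> $ 0 + 1)"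
    using dim by (intro eq_vecI) (auto simp: kappa_shift_index)
  show "kappa_shift \<kappa> p = \<kappa> + ones_vec p"
    using dim by (intro eq_vecI) (auto simp: kappa_shift_index ones_vec_def)
qed

end
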